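(* Let $G$ be a connected graph with $|L_e(G)|\geq 3$ and $w(G)\leq 2|L_e(G)|+1$. Then $\chi(G)\leq 2|L_e(G)|+1$.
   Context: All graphs are finite, simple and undirected. $L_e(G)$ denotes the set of all even integers $m$ such that $G$ contains a cycle of length $m$. $w(G)$ denotes the clique number of $G$ (the number of vertices of a largest clique) and $\chi(G)$ the chromatic number. *)

theory Defs
  imports "Graph_Theory.Graph_Theory"
begin

text \<open>
  The locale \<^locale>\<open>graph\<close> models a finite simple undirected graph as a symmetric digraph:
  every undirected edge is a pair of opposite arcs.  Consequently the library predicate
  \<^const>\<open>pre_digraph.cycle\<close> also holds of the closed walk a, b, a along a single
  edge; the length bound excludes it (distinctness of the visited vertices is already part of
  the library predicate).
\<close>

definition undirected_cycle :: "('a, 'b) pre_digraph \<Rightarrow> 'b list \<Rightarrow> bool" where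
  "undirected_cycle G p \<longleftrightarrow> pre_digraph.cycle G p \<and> 3 \<le> length p"

definition even_cycle_lengths :: "('a, 'b) pre_digraph \<Rightarrow> nat set" where
  "even_cycle_lengths G = {m. even m \<and> (\<exists>p. undirected_cycle G p \<and> length p = m)}"

definition clique :: "('a, 'b) pre_digraph \<Rightarrow> 'a set \<Rightarrow> bool" where
  "clique G K \<longleftrightarrow> K \<subseteq> verts G \<and> (\<forall>u\<in>K. \<forall>v\<in>K. u \<noteq> v \<longrightarrow> u \<rightarrow>\<^bsub>G\<^esub> v)"

definition clique_number :: "('a, 'b) pre_digraph \<Rightarrow> nat" where
  "clique_number G = Max {card K | K. clique G K}"

definition proper_colouring :: "('a, 'b) pre_digraph \<Rightarrow> nat \<Rightarrow> ('a \<Rightarrow> nat) \<Rightarrow> bool" where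
  "proper_colouring G k c \<longleftrightarrow>
     c ` verts G \<subseteq> {..<k} \<and> (\<forall>u v. u \<rightarrow>\<^bsub>G\<^esub> v \<longrightarrow> c u \<noteq> c v)"

definition chromatic_number :: "('a, 'b) pre_digraph \<Rightarrow> nat" where
  "chromatic_number G = (LEAST k. \<exists>c. proper_colouring G k c)"

text \<open>
  For finite graphs the uses of \<^const>\<open>card\<close>, \<^const>\<open>Max\<close> and
  \<^const>\<open>Least\<close> are not degenerate.
\<close>

lemma (in graph) finite_even_cycle_lengths: "finite (even_cycle_lengths G)"
proof -
  have "length p \<le> card (arcs G)" if "cycle p" for p
  proof -
    from that obtain u where "awalk u p u" "distinct p"
      unfolding cycle_conv by blast
    then have "set p \<subseteq> arcs G" by (auto simp: awalk_def)
    then show ?thesis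
      using \<open>distinct p\<close> by (metis card_mono distinct_card finite_arcs)
  qed
  then have "even_cycle_lengths G \<subseteq> {..card (arcs G)}"
    by (auto simp: even_cycle_lengths_def undirected_cycle_def)
  then show ?thesis by (rule finite_subset) simp
qed

lemma (in graph) clique_number_attained: "\<exists>K. clique G K \<and> card K = clique_number G"
proof -
  let ?S = "{card K | K. clique G K}"
  have "?S \<subseteq> card ` Pow (verts G)" by (auto simp: clique_def)
  then have "finite ?S" by (rule finite_subset) simp
  moreover have "clique G {}" by (simp add: clique_def)
  then have "?S \<noteq> {}" by blast
  ultimately have "clique_number G \<in> ?S"
    unfolding clique_number_def by (rule Max_in)
  then show ?thesis by auto
qed

lemma (in graph) chromatic_number_attained: "\<exists>c. proper_colouring G (chromatic_number G) c"
proof -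
  obtain c :: "'a \<Rightarrow> nat" and n where "c ` verts G = {i. i < n}" "inj_on c (verts G)"
    using finite_imp_inj_to_nat_seg[OF finite_verts] by blast
  moreover have "u \<in> verts G \<and> v \<in> verts G \<and> u \<noteq> v" if "u \<rightarrow>\<^bsub>G\<^esub> v" for u v
    using that adj_not_same adj_in_verts by blast
  ultimately have "proper_colouring G n c"
    unfolding proper_colouring_def inj_on_def by (metis lessThan_def order_refl)
  then have "\<exists>k c. proper_colouring G k c" by blast
  then show ?thesis
    unfolding chromatic_number_def by (rule LeastI_ex)
qed

end

theory Submission
  imports Defs
begin

text \<open>
  Let $k = |L_e(G)|$ and let $W$ induce a subgraph that is minimal subject to not being
  $(2k+1)$-colourable, so all its degrees are at least $2k+1$. All neighbours of an end of a longest
  path of $W$ lie on that path. Two neighbours at positions $i < j$ of equal parity close an even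
  cycle of length $j - i + 2$, so at most $k+1$ neighbours have each parity, and hence one parity
  has exactly $k+1$ of them. This forces $L_e = \{D+2, 2D+2, \dots, kD+2\}$. Rotating the path at
  a neighbour of its end (as in Posa's method) gives another longest path; comparing the two ends
  yields $D = 2$, and then, as no even cycle is longer than $2k+2$, that no neighbour of an
  end lies beyond position $2k+2$. So the first $2k+2$ vertices of a longest path form a clique, or
  the first $2k+3$ vertices are cut off by a single vertex, or they exhaust $W$. In the last case
  the complement is a matching, with two edges since there is no clique on $2k+2$ vertices, and $W$
  can be coloured after all.
\<close>

section \<open>Sets of naturals and colourings\<close>

text \<open>Descent as in Euclid's algorithm: subtracting the minimum \<open>d\<close> stays in
  \<open>S\<close> until \<open>d\<close> is reached, so \<open>d\<close> divides every element;
  descending from the maximum in steps of \<open>d\<close> meets every positive multiple up to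
  it.\<close>

lemma interval_multiples:
  fixes S :: "nat set"
  assumes fin: "finite S" and pos: "0 \<notin> S"
    and diff: "\<And>a b. a \<in> S \<Longrightarrow> b \<in> S \<Longrightarrow> a < b \<Longrightarrow> b - a \<in> S"
  shows "S = (*) (Min S) ` {1..card S}"
proof (cases "S = {}")
  case False
  define d where "d = Min S"
  have d: "d \<in> S" "\<And>s. s \<in> S \<Longrightarrow> d \<le> s" "0 < d"
    using fin False pos Min_in[of S] by (auto simp: d_def intro: gr0I)
  have dvd: "d dvd s" if "s \<in> S" for s
    using that
  proof (induction s rule: less_induct)
    case (less s)
    show ?case
    proof (cases "s = d")
      case False
      with d(2)[OF less.prems] have "d < s" by simp
      then have "s - d \<in> S" "s - d < s" using diff[OF d(1) less.prems] d(3) by auto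
      then have "d dvd s - d" using less.IH by blast
      then show ?thesis using \<open>d < s\<close> by (simp add: dvd_minus_self)
    qed simp
  qed
  define n where "n = Max S div d"
  have down: "d * (n - j) \<in> S" if "j < n" for j
    using that
  proof (induction j)
    case 0
    have "d dvd Max S" using dvd Max_in fin False by blast
    then show ?case using Max_in[OF fin False] by (simp add: n_def)
  next
    case (Suc j)
    then have "d * (n - j) \<in> S" "d < d * (n - j)" using d(3) by auto
    from diff[OF d(1) this] have "d * (n - j) - d \<in> S" .
    moreover have "d * (n - j) - d = d * (n - Suc j)"
      by (simp add: right_diff_distrib')
    ultimately show ?case by simp
  qed
  have S: "S = (*) d ` {1..n}"
  proof
    show "S \<subseteq> (*) d ` {1..n}"
    proof
      fix s assume s: "s \<in> S"
      then obtain i where i: "s = d * i" using dvd by blast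
      have "s \<le> Max S" using s fin by simp
      then have "i \<le> n" using i d(3) by (simp add: n_def less_eq_div_iff_mult_less_eq mult.commute)
      moreover have "i \<noteq> 0" using i s pos by (auto intro: ccontr)
      ultimately show "s \<in> (*) d ` {1..n}" using i by auto
    qed
    show "(*) d ` {1..n} \<subseteq> S"
    proof clarify
      fix i assume "i \<in> {1..n}"
      then show "d * i \<in> S" using down[of "n - i"] by auto
    qed
  qed
  have c: "card S = n"
    unfolding S using d(3) by (subst card_image) (auto simp: inj_on_def)
  show ?thesis unfolding d_def[symmetric] c by (rule S)
qed simp

text \<open>Applied to sets of neighbours that miss at most one of the candidates in
  \<open>C\<close>.\<close>

lemma card_ge_two_notin:
  assumes "finite C" "A \<subseteq> C" "card C \<le> Suc (card A)" "a \<in> C" "b \<in> C" "a \<noteq> b"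
  shows "a \<in> A \<or> b \<in> A"
proof (rule ccontr)
  assume "\<not> ?thesis"
  then have "A \<subseteq> C - {a, b}" using assms by auto
  then have "card A \<le> card (C - {a, b})" using assms by (intro card_mono) auto
  moreover have "card (C - {a, b}) = card C - 2"
    using assms by (simp add: card_Diff_subset)
  moreover have "card {a, b} \<le> card C" using assms by (intro card_mono) auto
  ultimately show False using assms by simp
qed

section \<open>Colourings of vertex sets\<close>

definition colourable :: "('a \<Rightarrow> 'a \<Rightarrow> bool) \<Rightarrow> nat \<Rightarrow> 'a set \<Rightarrow> bool" where
  "colourable E n S \<longleftrightarrow> (\<exists>f. f ` S \<subseteq> {..<n} \<and> (\<forall>u\<in>S. \<forall>v\<in>S. E u v \<longrightarrow> f u \<noteq> f v))"

text \<open>With fewer than \<open>n\<close> neighbours in \<open>W\<close>, some colour stays free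
  for \<open>w\<close> in any colouring of the rest.\<close>

lemma degree_ge_if_not_colourable:
  assumes sym: "\<And>u v. E u v \<Longrightarrow> E v u" and irrefl: "\<And>u. \<not> E u u"
    and fin: "finite W" and w: "w \<in> W"
    and W: "\<not> colourable E n W" and Ww: "colourable E n (W - {w})"
  shows "n \<le> card {v \<in> W. E w v}"
proof (rule ccontr)
  assume "\<not> ?thesis"
  then have less: "card {v \<in> W. E w v} < n" by simp
  obtain f where f: "f ` (W - {w}) \<subseteq> {..<n}"
    "\<And>u v. u \<in> W - {w} \<Longrightarrow> v \<in> W - {w} \<Longrightarrow> E u v \<Longrightarrow> f u \<noteq> f v"
    using Ww by (auto simp: colourable_def)
  have "card (f ` {v \<in> W. E w v}) < card {..<n}"
    using less card_image_le[of "{v \<in> W. E w v}" f] fin by simp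
  then have "\<not> {..<n} \<subseteq> f ` {v \<in> W. E w v}"
    using card_mono[of "f ` {v \<in> W. E w v}" "{..<n}"] fin by auto
  then obtain x where x: "x < n" "x \<notin> f ` {v \<in> W. E w v}" by auto
  have "colourable E n W"
    unfolding colourable_def
  proof (intro exI[of _ "f(w := x)"] conjI ballI impI)
    show "(f(w := x)) ` W \<subseteq> {..<n}" using f(1) x(1) by auto
    fix u v assume uv: "u \<in> W" "v \<in> W" "E u v"
    then show "(f(w := x)) u \<noteq> (f(w := x)) v"
      using f(2)[of u v] x(2) irrefl sym[OF uv(3)] by (auto simp: image_iff)
  qed
  then show False using W by blast
qed

text \<open>The two coloured sets share only \<open>c\<close>, and \<open>closed\<close> rules out
  edges between their other vertices, so it suffices to make the colourings agree at
  \<open>c\<close>.\<close>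

lemma colourable_cut_vertex:
  assumes sym: "\<And>u v. E u v \<Longrightarrow> E v u"
    and A: "colourable E n A" and B: "colourable E n (W - (A - {c}))"
    and c: "c \<in> A" "c \<in> W" and closed: "\<And>u v. u \<in> A - {c} \<Longrightarrow> v \<in> W \<Longrightarrow> E u v \<Longrightarrow> v \<in> A"
  shows "colourable E n W"
proof -
  obtain f where f: "\<And>u. u \<in> A \<Longrightarrow> f u < n"
    "\<And>u v. u \<in> A \<Longrightarrow> v \<in> A \<Longrightarrow> E u v \<Longrightarrow> f u \<noteq> f v"
    using A by (auto simp: colourable_def)
  obtain g where "g ` (W - (A - {c})) \<subseteq> {..<n}"
    "\<forall>u\<in>W - (A - {c}). \<forall>v\<in>W - (A - {c}). E u v \<longrightarrow> g u \<noteq> g v"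
    using B unfolding colourable_def by blast
  then have g: "\<And>u. u \<in> W - (A - {c}) \<Longrightarrow> g u < n"
    "\<And>u v. u \<in> W - (A - {c}) \<Longrightarrow> v \<in> W - (A - {c}) \<Longrightarrow> E u v \<Longrightarrow> g u \<noteq> g v"
    by blast+
  \<comment> \<open>The transposition of \<open>g c\<close> and \<open>f c\<close> keeps
    \<open>g\<close> proper and gives \<open>c\<close> the colour \<open>f c\<close>.\<close>
  define \<pi> where "\<pi> x = (if x = g c then f c else if x = f c then g c else x)" for x
  have \<pi>: "\<pi> x = \<pi> y \<longleftrightarrow> x = y" "\<pi> (g c) = f c" for x y by (auto simp: \<pi>_def)
  define h where "h u = (if u \<in> A then f u else \<pi> (g u))" for u
  have cross: "h u \<noteq> h v" if "u \<in> A" "v \<in> W" "v \<notin> A" "E u v" for u v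
  proof -
    have "u = c" using closed[of u v] that by auto
    then have "g c \<noteq> g v" using g(2)[of c v] that c by auto
    then show ?thesis using \<pi>(1)[of "g c" "g v"] \<pi>(2) that \<open>u = c\<close> by (simp add: h_def)
  qed
  show ?thesis
    unfolding colourable_def
  proof (intro exI[of _ h] conjI ballI impI)
    show "h ` W \<subseteq> {..<n}"
      using f(1) g(1) c by (auto simp: h_def \<pi>_def)
    fix u v assume uv: "u \<in> W" "v \<in> W" "E u v"
    show "h u \<noteq> h v"
    proof (cases "u \<in> A"; cases "v \<in> A")
      assume "u \<in> A" "v \<notin> A"
      then show ?thesis using cross uv by blast
    next
      assume "u \<notin> A" "v \<in> A"
      then show ?thesis using cross[of v u] uv sym[OF uv(3)] by metis
    next
      assume "u \<in> A" "v \<in> A"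
      then show ?thesis using f(2) uv by (simp add: h_def)
    next
      assume "u \<notin> A" "v \<notin> A"
      then show ?thesis using g(2)[of u v] uv \<pi>(1) by (simp add: h_def)
    qed
  qed
qed

text \<open>Each pair shares one colour, which saves two of \<open>n + 2\<close> colours.\<close>

lemma colourable_two_nonadjacent_pairs:
  assumes sym: "\<And>u v. E u v \<Longrightarrow> E v u" and irrefl: "\<And>u. \<not> E u u"
    and fin: "finite W" "card W = n + 2"
    and W: "{a, b, c, d} \<subseteq> W" "distinct [a, b, c, d]" and non: "\<not> E a b" "\<not> E c d"
  shows "colourable E n W"
proof -
  have "card (W - {b, d}) = n" using fin W by (subst card_Diff_subset) auto
  then obtain f where f: "bij_betw f (W - {b, d}) {..<n}"
    using fin ex_bij_betw_finite_nat[of "W - {b, d}"] by (auto simp: atLeast0LessThan)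
  define h where "h = f(b := f a, d := f c)"
  have inj: "f u = f v \<longleftrightarrow> u = v" if "u \<in> W - {b, d}" "v \<in> W - {b, d}" for u v
    using inj_on_eq_iff[OF bij_betw_imp_inj_on[OF f] that] .
  have rng: "f u < n" if "u \<in> W - {b, d}" for u
    using bij_betw_apply[OF f that] by simp
  show ?thesis
    unfolding colourable_def
  proof (intro exI[of _ h] conjI ballI impI)
    show "h ` W \<subseteq> {..<n}" using rng W by (auto simp: h_def)
    fix u v assume uv: "u \<in> W" "v \<in> W" "E u v"
    have "u \<noteq> v" "\<not> E b a" "\<not> E d c" using uv irrefl non sym by metis+
    then show "h u \<noteq> h v"
      using uv non W inj[of u v] inj[of u a] inj[of u c] inj[of a v] inj[of c v] inj[of a c]
        inj[of c a]
      by (auto simp: h_def)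
  qed
qed

section \<open>Longest paths in a graph with few even cycle lengths\<close>

text \<open>\<open>W\<close> is to be a minimal non-colourable vertex set, while \<open>L\<close>
  belongs to the whole graph; hence \<open>cycle_L\<close> is only an inclusion. Of the minimality,
  the locale keeps \<open>deg\<close>.\<close>

locale few_even_cycles =
  fixes E :: "'a \<Rightarrow> 'a \<Rightarrow> bool" and W :: "'a set" and L :: "nat set" and k :: nat
  assumes sym: "E u v \<Longrightarrow> E v u" and irrefl: "\<not> E u u"
    and finW: "finite W" and W_ne: "W \<noteq> {}"
    and finL: "finite L" and card_L: "card L = k" and k3: "3 \<le> k"
    and L_even: "l \<in> L \<Longrightarrow> even l" and L_gt: "l \<in> L \<Longrightarrow> 2 < l"
    and cycle_L: "\<lbrakk>set c \<subseteq> W; distinct c; 3 \<le> length c; even (length c);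
       successively E c; E (last c) (hd c)\<rbrakk> \<Longrightarrow> length c \<in> L"
    and deg: "w \<in> W \<Longrightarrow> 2 * k + 1 \<le> card {v \<in> W. E w v}"
begin

text \<open>There are \<open>m\<close> edges and \<open>m + 1\<close> vertices. With functions on
  positions, cycle lengths and parities become arithmetic of positions.\<close>

definition path :: "nat \<Rightarrow> (nat \<Rightarrow> 'a) \<Rightarrow> bool" where
  "path m p \<longleftrightarrow> inj_on p {..m} \<and> p ` {..m} \<subseteq> W \<and> (\<forall>i<m. E (p i) (p (Suc i)))"

definition len :: nat where
  "len = (GREATEST m. \<exists>p. path m p)"

abbreviation lpath :: "(nat \<Rightarrow> 'a) \<Rightarrow> bool" where
  "lpath \<equiv> path len"

definition N :: "(nat \<Rightarrow> 'a) \<Rightarrow> nat set" where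
  "N p = {i \<in> {1..len}. E (p 0) (p i)}"

text \<open>Rotation at a neighbour \<open>p x\<close> of the end \<open>p 0\<close>: the initial segment is reversed, the positions
  from \<open>x\<close> on do not move, and \<open>p (x - 1)\<close> becomes the new end.\<close>

definition rot :: "(nat \<Rightarrow> 'a) \<Rightarrow> nat \<Rightarrow> nat \<Rightarrow> 'a" where
  "rot p x i = (if i < x then p (x - 1 - i) else p i)"

section \<open>Longest paths and their rotations\<close>

lemma path_bound: "path m p \<Longrightarrow> m \<le> card W"
  using card_inj_on_le[of p "{..m}" W] finW by (auto simp: path_def)

lemma lpath_ex: "\<exists>p. lpath p"
proof -
  obtain w where "w \<in> W" using W_ne by blast
  then have "path 0 (\<lambda>_. w)" by (simp add: path_def)
  then have "\<exists>p. path 0 p" by blast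
  then show ?thesis
    unfolding len_def by (rule GreatestI_nat[where b = "card W"]) (auto dest: path_bound)
qed

lemma path_le_len: "path m p \<Longrightarrow> m \<le> len"
  unfolding len_def by (rule Greatest_le_nat[where b = "card W"]) (auto dest: path_bound)

lemma lpath_in_W: "lpath p \<Longrightarrow> i \<le> len \<Longrightarrow> p i \<in> W"
  by (auto simp: path_def)

lemma lpath_step: "lpath p \<Longrightarrow> i < len \<Longrightarrow> E (p i) (p (Suc i))"
  by (auto simp: path_def)

lemma lpath_inj: "lpath p \<Longrightarrow> i \<le> len \<Longrightarrow> j \<le> len \<Longrightarrow> p i = p j \<longleftrightarrow> i = j"
  by (auto simp: path_def inj_on_def)

lemma finite_N: "finite (N p)" by (simp add: N_def)

text \<open>A neighbour \<open>v\<close> off the path could be prepended, as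
  \<open>case_nat v p\<close>, giving a longer path.\<close>

lemma nbr_on_path:
  assumes p: "lpath p" and v: "v \<in> W" "E (p 0) v"
  shows "\<exists>i \<in> N p. v = p i"
proof (cases "v \<in> p ` {..len}")
  case True
  then obtain i where "i \<le> len" "v = p i" by auto
  moreover have "i \<noteq> 0" using calculation v irrefl by metis
  ultimately have "i \<in> N p" using v by (simp add: N_def)
  then show ?thesis using \<open>v = p i\<close> by blast
next
  case False
  define q where "q = case_nat v p"
  have "path (Suc len) q"
    unfolding path_def
  proof (intro conjI allI impI)
    show "inj_on q {..Suc len}"
      using False lpath_inj[OF p] by (auto simp: inj_on_def q_def split: nat.splits)
    show "q ` {..Suc len} \<subseteq> W"
      using v lpath_in_W[OF p] by (auto simp: q_def split: nat.splits)
    show "E (q i) (q (Suc i))" if "i < Suc len" for i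
      using that v sym lpath_step[OF p] by (auto simp: q_def split: nat.splits)
  qed
  then show ?thesis using path_le_len by fastforce
qed

lemma card_N: "lpath p \<Longrightarrow> 2 * k + 1 \<le> card (N p)"
proof -
  assume p: "lpath p"
  have "2 * k + 1 \<le> card {v \<in> W. E (p 0) v}"
    using deg lpath_in_W[OF p, of 0] by simp
  also have "\<dots> \<le> card (p ` N p)"
    using nbr_on_path[OF p] finite_N by (intro card_mono) auto
  also have "\<dots> \<le> card (N p)" using finite_N by (rule card_image_le)
  finally show ?thesis .
qed

lemma len_ge: "2 * k + 1 \<le> len"
proof -
  obtain p where p: "lpath p" using lpath_ex by blast
  have "card (N p) \<le> card {1..len}" by (intro card_mono) (auto simp: N_def)
  then show ?thesis using card_N[OF p] by simp
qed

lemma one_N: "lpath p \<Longrightarrow> 1 \<in> N p"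
  using len_ge k3 lpath_step[of p 0] by (auto simp: N_def)

lemma N_le: "i \<in> N p \<Longrightarrow> i \<le> len" and N_pos: "i \<in> N p \<Longrightarrow> 1 \<le> i"
  and N_E: "i \<in> N p \<Longrightarrow> E (p 0) (p i)" and N_E': "i \<in> N p \<Longrightarrow> E (p i) (p 0)"
  by (auto simp: N_def intro: sym)

lemma lpath_rot:
  assumes p: "lpath p" and x: "x \<in> N p"
  shows "lpath (rot p x)"
  unfolding path_def
proof (intro conjI allI impI)
  have xl: "x \<le> len" "1 \<le> x" "E (p 0) (p x)" using x by (auto simp: N_def)
  show "inj_on (rot p x) {..len}"
    using xl lpath_inj[OF p] by (auto simp: inj_on_def rot_def split: if_splits)
  show "rot p x ` {..len} \<subseteq> W"
    using xl lpath_in_W[OF p] by (auto simp: rot_def)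
  fix i assume i: "i < len"
  consider "Suc i < x" | "Suc i = x" | "x \<le> i" by linarith
  then show "E (rot p x i) (rot p x (Suc i))"
  proof cases
    case 1
    then have "E (p (x - 2 - i)) (p (Suc (x - 2 - i)))"
      using lpath_step[OF p] xl by simp
    moreover have "Suc (x - 2 - i) = x - 1 - i" "x - 1 - Suc i = x - 2 - i" using 1 by auto
    ultimately show ?thesis using 1 sym by (auto simp: rot_def)
  next
    case 2
    then show ?thesis using xl by (auto simp: rot_def)
  next
    case 3
    then show ?thesis using lpath_step[OF p] i by (auto simp: rot_def)
  qed
qed

lemma in_N_rot:
  assumes "lpath p" "x \<in> N p" "1 \<le> i" "i \<le> len"
  shows "i \<in> N (rot p x) \<longleftrightarrow> (if i < x then E (p (x - 1)) (p (x - 1 - i)) else E (p (x - 1)) (p i))"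
  using assms by (auto simp: N_def rot_def)

section \<open>Cycles given by positions on a longest path, and the shape of
  \<open>L\<close>\<close>

lemma cycle_on_path:
  assumes p: "lpath p" and xs: "set xs \<subseteq> {..len}" "distinct xs" "length xs = n" "3 \<le> n" "even n"
    and E: "successively (\<lambda>i j. E (p i) (p j)) xs" "E (p (last xs)) (p (hd xs))"
  shows "n \<in> L"
proof -
  have ne: "xs \<noteq> []" using xs by auto
  have "length (map p xs) \<in> L"
  proof (rule cycle_L)
    show "set (map p xs) \<subseteq> W" using xs lpath_in_W[OF p] by auto
    show "distinct (map p xs)"
      using xs p by (auto simp: distinct_map path_def intro: inj_on_subset)
    show "successively E (map p xs)" using E by (simp add: successively_map)
    show "E (last (map p xs)) (hd (map p xs))" using E ne by (simp add: last_map hd_map)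
  qed (use xs in auto)
  then show ?thesis using xs by simp
qed

lemma path_up: "lpath p \<Longrightarrow> j \<le> Suc len \<Longrightarrow> successively (\<lambda>i j. E (p i) (p j)) [i..<j]"
proof (induction j)
  case (Suc j)
  then show ?case
    using lpath_step[of p "j - 1"]
    by (cases "i < j") (auto simp: successively_append_iff)
qed simp

lemma path_down: "lpath p \<Longrightarrow> j \<le> Suc len \<Longrightarrow> successively (\<lambda>i j. E (p i) (p j)) (rev [i..<j])"
proof -
  assume "lpath p" "j \<le> Suc len"
  from path_up[OF this, of i] show ?thesis
    unfolding successively_rev by (rule successively_mono) (auto intro: sym)
qed

lemma N_diff:
  assumes p: "lpath p" and ij: "i \<in> N p" "j \<in> N p" "i < j" "even (j - i)"
  shows "j - i + 2 \<in> L"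
proof -
  have *: "1 \<le> i" "j \<le> len" using ij by (auto simp: N_def)
  show ?thesis
  proof (rule cycle_on_path[OF p, of "0 # [i..<Suc j]"])
    show "successively (\<lambda>i j. E (p i) (p j)) (0 # [i..<Suc j])"
      using path_up[OF p, of "Suc j" i] * ij N_E[OF ij(1)] by (simp add: successively_Cons upt_rec)
  qed (use * ij N_E'[OF ij(2)] in \<open>auto simp: Suc_diff_le\<close>)
qed

text \<open>The common difference of \<open>L\<close> once it is known to be an arithmetic
  progression starting at \<open>D + 2\<close>.\<close>

definition D :: nat where "D = Min L - 2"

text \<open>The differences from \<open>Min T\<close> are distinct elements of \<open>S\<close>, the
  set \<open>L\<close> shifted down by 2. If \<open>T\<close> has \<open>k + 1\<close> elements they
  exhaust \<open>S\<close>, which is then closed under positive differences, so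
  \<open>interval_multiples\<close> applies.\<close>

lemma card_diffs:
  fixes T :: "nat set"
  assumes fin: "finite T" and T: "\<And>i j. i \<in> T \<Longrightarrow> j \<in> T \<Longrightarrow> i < j \<Longrightarrow> j - i + 2 \<in> L"
  shows "card T \<le> k + 1"
    and "card T = k + 1 \<Longrightarrow> L = (\<lambda>i. D * i + 2) ` {1..k}"
proof -
  define S where "S = (\<lambda>l. l - 2) ` L"
  have S_iff: "s \<in> S \<longleftrightarrow> s + 2 \<in> L" for s
  proof
    assume "s \<in> S"
    then obtain l where "l \<in> L" "s = l - 2" by (auto simp: S_def)
    then show "s + 2 \<in> L" using L_gt[of l] le_add_diff_inverse2[of 2 l] by (metis less_imp_le)
  next
    assume "s + 2 \<in> L"
    then show "s \<in> S" unfolding S_def by (rule rev_image_eqI) simp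
  qed
  have inj: "inj_on (\<lambda>l. l - 2) L"   proof (rule inj_onI)
    fix a b assume "a \<in> L" "b \<in> L" "a - 2 = b - 2"
    then show "a = b" using L_gt[of a] L_gt[of b] by linarith
  qed
  have S: "finite S" "card S = k"
    using finL card_L card_image[OF inj] by (simp_all add: S_def)
  have S0: "0 \<notin> S" using L_gt[of 2] unfolding S_iff add_0 by blast
  define T' where "T' = (\<lambda>t. t - Min T) ` (T - {Min T})"
  have sub: "T' \<subseteq> S" if "T \<noteq> {}"
  proof -
    have "t - Min T \<in> S" if t: "t \<in> T" "t \<noteq> Min T" for t
    proof -
      have "Min T < t" using t Min_le[OF fin, of t] by linarith
      then show ?thesis unfolding S_iff using T Min_in[OF fin \<open>T \<noteq> {}\<close>] t by blast
    qed
    then show ?thesis by (auto simp: T'_def)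
  qed
  have cT': "card T' = card T - 1" if "T \<noteq> {}"
  proof -
    have "inj_on (\<lambda>t. t - Min T) (T - {Min T})"
    proof (rule inj_onI)
      fix a b assume "a \<in> T - {Min T}" "b \<in> T - {Min T}" "a - Min T = b - Min T"
      then show "a = b" using Min_le[OF fin, of a] Min_le[OF fin, of b] by auto
    qed
    then show ?thesis
      using Min_in[OF fin that] by (simp add: T'_def card_image)
  qed
  show "card T \<le> k + 1"
    using card_mono[OF S(1) sub] cT' S by (cases "T = {}") auto
  assume c: "card T = k + 1"
  then have ne: "T \<noteq> {}" by auto
  have eq: "T' = S"
    using card_subset_eq[OF S(1) sub[OF ne]] cT'[OF ne] c S by simp
  have "b - a \<in> S" if ab: "a \<in> S" "b \<in> S" "a < b" for a b
  proof -
    obtain s t where st: "s \<in> T" "t \<in> T" "a = s - Min T" "b = t - Min T"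
      using ab unfolding eq[symmetric] T'_def by auto
    have "Min T \<le> s" "Min T \<le> t" using st fin by auto
    then have "b - a = t - s" "s < t" using st ab by linarith+
    then show ?thesis unfolding S_iff using T[OF st(1,2)] by (simp only:)
  qed
  from interval_multiples[OF S(1) S0 this] S
  have *: "S = (*) (Min S) ` {1..k}" by simp
  have Lne: "L \<noteq> {}" using card_L k3 by auto
  have "Min S = D"
    unfolding S_def D_def
    by (rule mono_Min_commute[symmetric]) (use finL Lne in \<open>auto simp: mono_def\<close>)
  with * have "S = (*) D ` {1..k}" by simp
  moreover have "L = (\<lambda>s. s + 2) ` S"
  proof safe
    fix l assume "l \<in> L"
    then show "l \<in> (\<lambda>s. s + 2) ` S"
      using L_gt[of l] by (intro image_eqI[of _ _ "l - 2"]) (auto simp: S_def)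
  next
    fix s assume "s \<in> S"
    then show "s + 2 \<in> L" by (simp only: S_iff)
  qed
  ultimately show "L = (\<lambda>i. D * i + 2) ` {1..k}" by (auto simp: image_image)
qed

definition odds :: "(nat \<Rightarrow> 'a) \<Rightarrow> nat set" where "odds p = {i \<in> N p. odd i}"
definition evens :: "(nat \<Rightarrow> 'a) \<Rightarrow> nat set" where "evens p = {i \<in> N p. even i}"

lemma finite_odds: "finite (odds p)" and finite_evens: "finite (evens p)"
  by (auto simp: odds_def evens_def finite_N)

text \<open>Each parity class has at most \<open>k + 1\<close> elements and together they have at
  least \<open>2 * k + 1\<close>, so both have at least \<open>k\<close> and one is full. The odd
  class is the one kept, as position 1 anchors it.\<close>

lemma card_odds_evens:
  assumes p: "lpath p"
  shows "k \<le> card (odds p)" "L = (\<lambda>i. D * i + 2) ` {1..k}"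
proof -
  have o: "j - i + 2 \<in> L" if "i \<in> odds p" "j \<in> odds p" "i < j" for i j
    using N_diff[OF p] that by (auto simp: odds_def)
  have e: "j - i + 2 \<in> L" if "i \<in> evens p" "j \<in> evens p" "i < j" for i j
    using N_diff[OF p] that by (auto simp: evens_def)
  have "N p = odds p \<union> evens p" "odds p \<inter> evens p = {}"
    by (auto simp: odds_def evens_def)
  then have s: "2 * k + 1 \<le> card (odds p) + card (evens p)"
    using card_N[OF p] by (simp add: card_Un_disjoint finite_odds finite_evens)
  have b: "card (odds p) \<le> k + 1" "card (evens p) \<le> k + 1"
    using card_diffs(1)[OF finite_odds o] card_diffs(1)[OF finite_evens e] by auto
  show "k \<le> card (odds p)" using s b by linarith
  have "card (odds p) = k + 1 \<or> card (evens p) = k + 1" using s b by linarith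
  then show "L = (\<lambda>i. D * i + 2) ` {1..k}"
    using card_diffs(2)[OF finite_odds o] card_diffs(2)[OF finite_evens e] by blast
qed

lemma L_iff: "l \<in> L \<longleftrightarrow> (\<exists>i. 1 \<le> i \<and> i \<le> k \<and> l = D * i + 2)"
proof -
  have "L = (\<lambda>i. D * i + 2) ` {1..k}" using card_odds_evens lpath_ex by blast
  then have "l \<in> L \<longleftrightarrow> l \<in> (\<lambda>i. D * i + 2) ` {1..k}" by (rule arg_cong)
  then show ?thesis by auto
qed

lemma D_pos: "0 < D" and D_even: "even D"
proof -
  have "D + 2 \<in> L" using k3 unfolding L_iff by (intro exI[of _ 1]) auto
  then show "0 < D" "even D" using L_gt[of "D + 2"] L_even[of "D + 2"] by auto
qed

text \<open>Position 1 is always a neighbour, so every other odd neighbour differs from it by a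
  multiple of \<open>D\<close>.\<close>

lemma odds_subset:
  assumes p: "lpath p"
  shows "odds p \<subseteq> (\<lambda>i. D * i + 1) ` {0..k}"
proof
  fix j assume j: "j \<in> odds p"
  show "j \<in> (\<lambda>i. D * i + 1) ` {0..k}"
  proof (cases "j = 1")
    case False
    then have "1 < j" using j N_pos by (force simp: odds_def)
    then have "j - 1 + 2 \<in> L"
      using N_diff[OF p one_N[OF p]] j by (auto simp: odds_def)
    then obtain i where "i \<le> k" "j - 1 + 2 = D * i + 2" unfolding L_iff by blast
    then show ?thesis using \<open>1 < j\<close> by (intro image_eqI[of _ _ i]) auto
  qed auto
qed

text \<open>At least \<open>k\<close> of the \<open>k + 1\<close> slots from
  \<open>odds_subset\<close> are occupied.\<close>

lemma one_of_two_slots: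
  assumes p: "lpath p" and "i \<le> k" "j \<le> k" "i \<noteq> j"
  shows "D * i + 1 \<in> N p \<or> D * j + 1 \<in> N p"
proof -
  have "card ((\<lambda>i. D * i + 1) ` {0..k}) = k + 1"
    using D_pos by (subst card_image) (auto simp: inj_on_def)
  then have "D * i + 1 \<in> odds p \<or> D * j + 1 \<in> odds p"
    using assms D_pos card_odds_evens(1)[OF p] odds_subset[OF p]
    by (intro card_ge_two_notin[of "(\<lambda>i. D * i + 1) ` {0..k}"]) auto
  then show ?thesis by (auto simp: odds_def)
qed

section \<open>The common difference \<open>D\<close> is 2\<close>

lemma D_eq_2_if_short_cycle: "4 \<in> L \<or> D + 4 \<in> L \<Longrightarrow> D = 2"
proof -
  \<comment> \<open>Either cycle length makes \<open>D\<close> divide 2, while \<open>D\<close> is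
    even.\<close>
  have *: "D = 2" if "D dvd 2"
    using that D_even by (metis dvd_antisym)
  assume "4 \<in> L \<or> D + 4 \<in> L"
  then show ?thesis
  proof
    assume "4 \<in> L"
    then obtain i where "4 = D * i + 2" unfolding L_iff by blast
    then have "2 = D * i" by simp
    then show ?thesis using * by (metis dvd_triv_left)
  next
    assume "D + 4 \<in> L"
    then obtain i where "D + 4 = D * i + 2" unfolding L_iff by blast
    then have "D * i = D + 2" by simp
    then have "D dvd D + 2" by (metis dvd_triv_left)
    then have "D dvd 2" by (metis dvd_add_right_iff dvd_refl)
    then show ?thesis by (rule *)
  qed
qed

text \<open>Here \<open>p d\<close> is the end obtained by rotating at \<open>Suc d\<close>. The
  cycle leaves \<open>p 0\<close>, traverses the segment between \<open>a\<close> and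
  \<open>b\<close> in one of the two directions, and returns through \<open>p d\<close> and
  \<open>p (Suc d)\<close>.\<close>

lemma cycle_two_chords:
  assumes p: "lpath p" and d: "0 < d" "Suc d < a" and ab: "a \<le> b" "b \<le> len" "even (b - a)"
    and E: "E (p (Suc d)) (p 0)"
      "E (p 0) (p a) \<and> E (p b) (p d) \<or> E (p 0) (p b) \<and> E (p a) (p d)"
  shows "b - a + 4 \<in> L"
  using E(2)
proof
  assume *: "E (p 0) (p a) \<and> E (p b) (p d)"
  show ?thesis
  proof (rule cycle_on_path[OF p, of "0 # [a..<Suc b] @ [d, Suc d]"])
    show "successively (\<lambda>i j. E (p i) (p j)) (0 # [a..<Suc b] @ [d, Suc d])"
      using * d ab path_up[OF p, of "Suc b" a] lpath_step[OF p, of d]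
      by (simp add: successively_Cons successively_append_iff hd_append del: upt_Suc)
  qed (use d ab E(1) in auto)
next
  assume *: "E (p 0) (p b) \<and> E (p a) (p d)"
  show ?thesis
  proof (rule cycle_on_path[OF p, of "0 # rev [a..<Suc b] @ [d, Suc d]"])
    show "successively (\<lambda>i j. E (p i) (p j)) (0 # rev [a..<Suc b] @ [d, Suc d])"
      using * d ab path_down[OF p, of "Suc b" a] lpath_step[OF p, of d]
      by (simp add: successively_Cons successively_append_iff hd_append last_rev hd_rev del: upt_Suc)
  qed (use d ab E(1) in auto)
qed

text \<open>Both \<open>p 0\<close> and the rotated end \<open>p D\<close> have a neighbour in slot
  2 or 3. The segment between these neighbours has length 0 or \<open>D\<close>, so
  \<open>cycle_two_chords\<close> gives a cycle of length 4 or \<open>D + 4\<close>.\<close>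

lemma D_eq_2_if_nbr:
  assumes p: "lpath p" and x: "D + 1 \<in> N p"
  shows "D = 2"
proof (rule D_eq_2_if_short_cycle)
  define q where "q = rot p (D + 1)"
  have q: "lpath q" unfolding q_def by (rule lpath_rot[OF p x])
  \<comment> \<open>Slots 2 and 3 lie beyond \<open>D + 1\<close>, so the rotation leaves their
    vertices in place.\<close>
  obtain i where i: "i = 2 \<or> i = 3" "D * i + 1 \<in> N p"
    using one_of_two_slots[OF p, of 2 3] k3 by auto
  obtain j where j: "j = 2 \<or> j = 3" "D * j + 1 \<in> N q"
    using one_of_two_slots[OF q, of 2 3] k3 by auto
  have ij: "E (p 0) (p (D * i + 1))" "E (p (D * j + 1)) (p D)"
  proof -
    show "E (p 0) (p (D * i + 1))" by (rule N_E[OF i(2)])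
    have "E (p D) (p (D * j + 1))"
      using j(1) in_N_rot[OF p x N_pos[OF j(2)] N_le[OF j(2)]] j(2) D_pos by (auto simp: q_def)
    then show "E (p (D * j + 1)) (p D)" by (rule sym)
  qed
  have e: "E (p (Suc D)) (p 0)" using N_E'[OF x] by simp
  have le: "D * i + 1 \<le> len" "D * j + 1 \<le> len" using N_le[OF i(2)] N_le[OF j(2)] by auto
  show "4 \<in> L \<or> D + 4 \<in> L"
  proof (cases "i \<le> j")
    case True
    have "D * j + 1 - (D * i + 1) + 4 \<in> L"
      by (rule cycle_two_chords[OF p D_pos _ _ _ _ e])
        (use True D_pos D_even i j le ij in auto)
    moreover have "D * j + 1 - (D * i + 1) = 0 \<or> D * j + 1 - (D * i + 1) = D"
      using True i j by auto
    ultimately show ?thesis by (metis add_0)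
  next
    case False
    have "D * i + 1 - (D * j + 1) + 4 \<in> L"
      by (rule cycle_two_chords[OF p D_pos _ _ _ _ e])
        (use False D_pos D_even i j le ij in auto)
    moreover have "D * i + 1 - (D * j + 1) = D"
      using False i j by auto
    ultimately show ?thesis by (metis)
  qed
qed

lemma D_eq_2: "D = 2"
proof -
  obtain p where p: "lpath p" using lpath_ex by blast
  show ?thesis
  proof (cases "D + 1 \<in> N p")
    case True
    then show ?thesis using D_eq_2_if_nbr[OF p] by blast
  next
    case False
    \<comment> \<open>Slot 1 is the only one missed, so a rotation at slot 2 is possible. Its new
      end \<open>p (D * 2)\<close> sees slot 1, or else shares the neighbour in slot 3 with
      \<open>p 0\<close>, which closes a 4-cycle.\<close>
    then have n: "D * 2 + 1 \<in> N p" "D * 3 + 1 \<in> N p"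
      using one_of_two_slots[OF p, of 1 2] one_of_two_slots[OF p, of 1 3] k3 by auto
    define q where "q = rot p (D * 2 + 1)"
    have q: "lpath q" unfolding q_def by (rule lpath_rot[OF p n(1)])
    show ?thesis
    proof (cases "D + 1 \<in> N q")
      case True
      then show ?thesis using D_eq_2_if_nbr[OF q] by blast
    next
      case False
      then have "D * 3 + 1 \<in> N q" using one_of_two_slots[OF q, of 1 3] k3 by auto
      then have "E (p (D * 2)) (p (D * 3 + 1))"
        using in_N_rot[OF p n(1) N_pos[OF n(2)] N_le[OF n(2)]] D_pos by (auto simp: q_def)
      moreover have "E (p (D * 2)) (p (D * 2 + 1))"
        using lpath_step[OF p, of "D * 2"] N_le[OF n(1)] by simp
      ultimately have "4 \<in> L"
        by (intro cycle_on_path[OF p, of "[0, D * 2 + 1, D * 2, D * 3 + 1]"])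
          (use D_pos N_le[OF n(1)] N_le[OF n(2)] N_E[OF n(1)] N_E'[OF n(2)] in \<open>auto intro: sym\<close>)
      then show ?thesis using D_eq_2_if_short_cycle by blast
    qed
  qed
qed

section \<open>Bounding the positions of neighbours of an end\<close>

lemma L_le: "l \<in> L \<Longrightarrow> l \<le> 2 * k + 2"
  unfolding L_iff D_eq_2 by auto

lemma odd_N_le: "lpath p \<Longrightarrow> i \<in> N p \<Longrightarrow> odd i \<Longrightarrow> i \<le> 2 * k + 1"
  using odds_subset[of p] unfolding odds_def D_eq_2 by force

text \<open>Even neighbours lie within \<open>2 * k\<close> of the largest one, \<open>M\<close>,
  and odd ones are at most \<open>2 * k + 1\<close>. This leaves at most \<open>2 * k + 2\<close>
  candidates, of which at most one is missed.\<close>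

lemma candidate:
  assumes p: "lpath p" and M: "M \<in> N p" "even M" "\<And>i. i \<in> N p \<Longrightarrow> i \<le> M"
    and s: "odd s \<and> s \<le> 2 * k + 1 \<or> even s \<and> M \<le> s + 2 * k \<and> s \<le> M"
    and t: "odd t \<and> t \<le> 2 * k + 1 \<or> even t \<and> M \<le> t + 2 * k \<and> t \<le> M"
    and "s \<noteq> t"
  shows "s \<in> N p \<or> t \<in> N p"
proof -
  \<comment> \<open>If \<open>M < 2 * k\<close>, truncated subtraction repeats the value 0; this is
    harmless, as only an upper bound on \<open>card C\<close> is needed.\<close>
  define C where "C = (\<lambda>i. 2 * i + 1) ` {..k} \<union> (\<lambda>i. M - 2 * i) ` {..k}"
  have C: "s \<in> C" if "odd s \<and> s \<le> 2 * k + 1 \<or> even s \<and> M \<le> s + 2 * k \<and> s \<le> M" for s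
    using that
  proof
    assume "odd s \<and> s \<le> 2 * k + 1"
    then show ?thesis by (auto simp: C_def elim!: oddE)
  next
    assume a: "even s \<and> M \<le> s + 2 * k \<and> s \<le> M"
    then have "s = M - 2 * ((M - s) div 2)" "(M - s) div 2 \<le> k" using M(2) by auto
    then show ?thesis unfolding C_def by blast
  qed
  show ?thesis
  proof (rule card_ge_two_notin[of C])
    show "finite C" by (simp add: C_def)
    have "card C \<le> card ((\<lambda>i. 2 * i + 1) ` {..k}) + card ((\<lambda>i. M - 2 * i) ` {..k})"
      unfolding C_def by (rule card_Un_le)
    also have "\<dots> \<le> Suc k + Suc k"
      using card_image_le[of "{..k}" "\<lambda>i. 2 * i + 1"] card_image_le[of "{..k}" "\<lambda>i. M - 2 * i"]
      by (intro add_mono) auto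
    finally show "card C \<le> Suc (card (N p))" using card_N[OF p] by simp
    show "N p \<subseteq> C"
    proof
      fix i assume i: "i \<in> N p"
      show "i \<in> C"
      proof (rule C, cases "odd i")
        case False
        have "M \<le> i + 2 * k"
        proof (cases "i = M")
          case False
          then have "M - i + 2 \<in> L"
            using M i \<open>\<not> odd i\<close> by (intro N_diff[OF p]) (auto simp: le_neq_implies_less)
          then show ?thesis using L_le by fastforce
        qed simp
        then show "odd i \<and> i \<le> 2 * k + 1 \<or> even i \<and> M \<le> i + 2 * k \<and> i \<le> M"
          using M(3) i False by simp
      qed (use odd_N_le[OF p i] in simp)
    qed
  qed (use assms C in auto)
qed

text \<open>If \<open>M > 2 * k + 2\<close>, then \<open>p 0, \<dots>, p M\<close> is an odd cycle, and by the maximality of \<open>M\<close> all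
  neighbours of both \<open>p 0\<close> and \<open>p (M - 1)\<close> lie on it. By \<open>candidate\<close> each of these two vertices
  misses at most one of \<open>2 * k + 2\<close> prescribed vertices of the cycle. The facts \<open>c1\<close> and \<open>c2\<close> leave two
  possibilities for the missed ones, and each yields a cycle of length \<open>2 * k + 4\<close>.\<close>

lemma farthest_nbr_le:
  assumes p: "lpath p" and Mp: "M \<in> N p" and max: "\<And>q i. lpath q \<Longrightarrow> i \<in> N q \<Longrightarrow> i \<le> M"
  shows "M \<le> 2 * k + 2"
proof (rule ccontr)
  assume "\<not> ?thesis"
  then have M: "2 * k + 4 \<le> M" "even M"
  proof -
    show "even M" using odd_N_le[OF p Mp] \<open>\<not> M \<le> 2 * k + 2\<close> by linarith
    then show "2 * k + 4 \<le> M" using \<open>\<not> M \<le> 2 * k + 2\<close> by presburger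
  qed
  define q where "q = rot p M"
  have q: "lpath q" unfolding q_def by (rule lpath_rot[OF p Mp])
  have Ml: "M \<le> len" using N_le[OF Mp] .
  have Nq: "i \<in> N q \<longleftrightarrow> E (p (M - 1)) (p (M - 1 - i))" if "1 \<le> i" "i < M" for i
    unfolding q_def using in_N_rot[OF p Mp, of i] that Ml by simp
  have e1: "E (p (M - 1)) (p M)" "E (p M) (p (M - 1))"
    using lpath_step[OF p, of "M - 1"] Ml M by (auto intro: sym)
  have Mq: "M \<in> N q"
    unfolding q_def using in_N_rot[OF p Mp, of M] M Ml e1 by simp
  note cp = candidate[OF p Mp M(2) max[OF p]]
  note cq = candidate[OF q Mq M(2) max[OF q]]
  \<comment> \<open>The length \<open>2 * k + 4\<close> exceeds every element of
    \<open>L\<close>.\<close>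
  have no: False if "length xs = 2 * k + 4" "set xs \<subseteq> {..len}" "distinct xs"
    "successively (\<lambda>i j. E (p i) (p j)) xs" "E (p (last xs)) (p (hd xs))" for xs
    using cycle_on_path[OF p that(2,3,1) _ _ that(4,5)] L_le[of "2 * k + 4"] by simp
  note simps = successively_Cons successively_append_iff hd_append last_rev hd_rev
  have c1: False if "2 * k + 1 \<in> N p" "M - 2 \<in> N q"
  proof (rule no)
    let ?xs = "0 # rev [1..<2 * k + 2] @ [M - 1, M]"
    show "length ?xs = 2 * k + 4" "set ?xs \<subseteq> {..len}" "distinct ?xs" using M Ml by auto
    have "E (p 1) (p (M - 1))" using that Nq[of "M - 2"] M by (auto intro: sym)
    then show "successively (\<lambda>i j. E (p i) (p j)) ?xs" "E (p (last ?xs)) (p (hd ?xs))"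
      using N_E[OF that(1)] N_E'[OF Mp] e1 path_down[OF p, of "2 * k + 2" 1] M Ml
      by (auto simp: simps simp del: upt_Suc)
  qed
  have c2: False if "M - 2 \<in> N p" "2 * k + 1 \<in> N q"
  proof (rule no)
    let ?xs = "0 # rev [M - 2 - 2 * k..<M - 1] @ [M - 1, M]"
    show "length ?xs = 2 * k + 4" "set ?xs \<subseteq> {..len}" "distinct ?xs" using M Ml by auto
    have "E (p (M - 2 - 2 * k)) (p (M - 1))" using that Nq[of "2 * k + 1"] M by (auto intro: sym)
    moreover have "M - 1 - 1 = M - 2" by simp
    ultimately show "successively (\<lambda>i j. E (p i) (p j)) ?xs" "E (p (last ?xs)) (p (hd ?xs))"
      using N_E[OF that(1)] N_E'[OF Mp] e1 path_down[OF p, of "M - 1" "M - 2 - 2 * k"] M Ml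
      by (auto simp: simps simp del: upt_Suc)
  qed
  have down4: "successively (\<lambda>i j. E (p i) (p j)) [M - 1, M - 2, M - 3, M - 4]"
  proof -
    have "Suc (M - 2) = M - 1" "Suc (M - 3) = M - 2" "Suc (M - 4) = M - 3" using M by auto
    then have "E (p (M - 1)) (p (M - 2))" "E (p (M - 2)) (p (M - 3))" "E (p (M - 3)) (p (M - 4))"
      using sym[OF lpath_step[OF p, of "M - 2"]] sym[OF lpath_step[OF p, of "M - 3"]]
        sym[OF lpath_step[OF p, of "M - 4"]] M Ml by auto
    then show ?thesis by simp
  qed
  have par: "2 * k + 1 \<noteq> M - 4" "2 * k + 1 \<noteq> M - 2" "3 \<noteq> M - 2" "M - 4 \<noteq> M - 2"
    using M by presburger+
  show False
  proof (cases "2 * k + 1 \<in> N p")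
    case False
    \<comment> \<open>Here both ends miss \<open>2 * k + 1\<close>, each counting along its own
      path, and so have all other candidates.\<close>
    have a1: "M - 2 \<in> N p" using cp[of "2 * k + 1" "M - 2"] False M k3 par by auto
    have a2: "2 * k + 1 \<notin> N q" using a1 c2 by blast
    have a3: "M - 2 \<in> N q" using cq[of "2 * k + 1" "M - 2"] a2 M k3 by auto
    have a4: "2 * k - 1 \<in> N p" using cp[of "2 * k + 1" "2 * k - 1"] False M k3 par by auto
    have a5: "M - 4 \<in> N p" using cp[of "2 * k + 1" "M - 4"] False M k3 par by auto
    show False
    proof (rule no)
      let ?xs = "0 # rev [1..<2 * k] @ [M - 1, M - 2, M - 3, M - 4]"
      show "length ?xs = 2 * k + 4" "set ?xs \<subseteq> {..len}" "distinct ?xs" using M Ml k3 by auto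
      have "E (p 1) (p (M - 1))" using a3 Nq[of "M - 2"] M by (auto intro: sym)
      then show "successively (\<lambda>i j. E (p i) (p j)) ?xs" "E (p (last ?xs)) (p (hd ?xs))"
        using N_E[OF a4] N_E'[OF a5] down4 path_down[OF p, of "2 * k" 1] M Ml k3
        by (auto simp: simps simp del: upt_Suc)
    qed
  next
    case True
    \<comment> \<open>Here both ends miss \<open>M - 2\<close>.\<close>
    have a1: "M - 2 \<notin> N q" using True c1 by blast
    have a2: "2 * k + 1 \<in> N q" using cq[of "2 * k + 1" "M - 2"] a1 M k3 par by auto
    have a3: "M - 2 \<notin> N p" using a2 c2 by blast
    \<comment> \<open>If \<open>M = 2 * k + 4\<close>, the cycle for larger \<open>M\<close> would
      visit \<open>M - 3\<close> and \<open>M - 4\<close> twice, so a different one is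
      needed.\<close>
    show False
    proof (cases "M = 2 * k + 4")
      case True
      have a4: "3 \<in> N p" using cp[of 3 "M - 2"] a3 M k3 par by auto
      show False
      proof (rule no)
        let ?xs = "0 # [3..<M] @ [2, 1]"
        show "length ?xs = 2 * k + 4" "set ?xs \<subseteq> {..len}" "distinct ?xs" using M Ml k3 True by auto
        have "E (p (M - 1)) (p 2)" using a2 Nq[of "2 * k + 1"] M True by auto
        moreover have "1 < len" using M Ml by linarith
        then have "E (p 2) (p 1)" using lpath_step[OF p, of 1] sym unfolding Suc_1 by blast
        ultimately show "successively (\<lambda>i j. E (p i) (p j)) ?xs" "E (p (last ?xs)) (p (hd ?xs))"
          using N_E[OF a4] N_E'[OF one_N[OF p]] path_up[OF p, of M 3] M Ml k3
          by (simp_all add: simps)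
      qed
    next
      case False
      then have M6: "2 * k + 6 \<le> M" using M by presburger
      have a4: "M - 4 \<in> N p" using cp[of "M - 4" "M - 2"] a3 M k3 par by auto
      have a5: "M - 4 \<in> N q" using cq[of "M - 4" "M - 2"] a1 M k3 par by auto
      show False
      proof (rule no)
        let ?xs = "0 # rev [3..<2 * k + 2] @ [M - 1, M - 2, M - 3, M - 4]"
        show "length ?xs = 2 * k + 4" "set ?xs \<subseteq> {..len}" "distinct ?xs" using M6 Ml k3 by auto
        have "M - 1 - (M - 4) = 3" using M6 by simp
        then have "E (p 3) (p (M - 1))" using a5 Nq[of "M - 4"] M6 by (auto intro: sym)
        then show "successively (\<lambda>i j. E (p i) (p j)) ?xs" "E (p (last ?xs)) (p (hd ?xs))"
          using N_E[OF True] N_E'[OF a4] down4 path_down[OF p, of "2 * k + 2" 3] M6 Ml k3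
          by (auto simp: simps simp del: upt_Suc)
      qed
    qed
  qed
qed

section \<open>A clique or a cut vertex\<close>

lemma rot_image:
  assumes "1 \<le> x" "x \<le> n"
  shows "rot p x ` {..n} = p ` {..n}"
proof
  show "rot p x ` {..n} \<subseteq> p ` {..n}" using assms by (auto simp: rot_def)
  show "p ` {..n} \<subseteq> rot p x ` {..n}"
  proof clarify
    fix i assume "i \<le> n"
    then show "p i \<in> rot p x ` {..n}"
      using assms by (intro image_eqI[of _ _ "if i < x then x - 1 - i else i"]) (auto simp: rot_def)
  qed
qed

text \<open>If no neighbour reaches \<open>2 * k + 2\<close>, every end sees exactly positions 1 to
  \<open>2 * k + 1\<close>, and rotations make the first \<open>2 * k + 2\<close> vertices a clique.
  Otherwise each of these vertices becomes an end after at most two rotations that preserve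
  \<open>U\<close>, so only \<open>p (2 * k + 2)\<close> can have neighbours outside
  \<open>U\<close>.\<close>

lemma clique_or_cut:
  assumes no_clique: "\<And>K. K \<subseteq> W \<Longrightarrow> (\<And>u v. u \<in> K \<Longrightarrow> v \<in> K \<Longrightarrow> u \<noteq> v \<Longrightarrow> E u v) \<Longrightarrow> card K \<le> 2 * k + 1"
  obtains U c where "U \<subseteq> W" "c \<in> U" "card U = 2 * k + 3"
    "\<And>u v. u \<in> U - {c} \<Longrightarrow> v \<in> W \<Longrightarrow> E u v \<Longrightarrow> v \<in> U"
proof -
  define M where "M = Max {i. \<exists>q. lpath q \<and> i \<in> N q}"
  have "finite {i. \<exists>q. lpath q \<and> i \<in> N q}"
    by (rule finite_subset[of _ "{..len}"]) (auto dest: N_le)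
  moreover have "{i. \<exists>q. lpath q \<and> i \<in> N q} \<noteq> {}"
    using lpath_ex one_N by blast
  ultimately have M: "M \<in> {i. \<exists>q. lpath q \<and> i \<in> N q}"
    "\<And>q i. lpath q \<Longrightarrow> i \<in> N q \<Longrightarrow> i \<le> M"
    unfolding M_def by (rule Max_in, auto intro: Max_ge)
  then obtain p where p: "lpath p" "M \<in> N p" by blast
  have M_le: "M \<le> 2 * k + 2" by (rule farthest_nbr_le[OF p M(2)])
  have N_le: "i \<le> 2 * k + 2" if "lpath q" "i \<in> N q" for q i
    using M(2)[OF that] M_le by simp
  show thesis
  proof (cases "M = 2 * k + 2")
    case False
    have N_eq: "N q = {1..2 * k + 1}" if q: "lpath q" for q
    proof (rule card_subset_eq)
      show "N q \<subseteq> {1..2 * k + 1}"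
        using M(2)[OF q] M_le False by (force dest: N_pos)
      then show "card (N q) = card {1..2 * k + 1}"
        using card_N[OF q] card_mono[of "{1..2 * k + 1}" "N q"] by simp
    qed simp
    have adj: "E (p i) (p j)" if "i < j" "j \<le> 2 * k + 1" for i j
    proof -
      have i: "Suc i \<in> N p" "j \<le> len" using that N_eq[OF p(1)] len_ge by auto
      have "j \<in> N (rot p (Suc i))" using N_eq[OF lpath_rot[OF p(1) i(1)]] that by auto
      then show ?thesis using in_N_rot[OF p(1) i(1)] that i by auto
    qed
    have "card (p ` {..2 * k + 1}) \<le> 2 * k + 1"
    proof (rule no_clique)
      show "p ` {..2 * k + 1} \<subseteq> W" using lpath_in_W[OF p(1)] len_ge by auto
      fix u v assume "u \<in> p ` {..2 * k + 1}" "v \<in> p ` {..2 * k + 1}" "u \<noteq> v"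
      then obtain i j where ij: "u = p i" "v = p j" "i \<noteq> j" "i \<le> 2 * k + 1" "j \<le> 2 * k + 1" by blast
      then show "E u v" using adj[of i j] adj[of j i] sym by (metis nat_neq_iff)
    qed
    moreover have "inj_on p {..2 * k + 1}"
      using p(1) len_ge by (auto simp: path_def intro: inj_on_subset)
    ultimately show thesis by (simp add: card_image)
  next
    case True
    define U where "U = p ` {..2 * k + 2}"
    have len: "2 * k + 2 \<le> len" using p(2) True by (simp add: N_def)
    have miss: "s \<in> N q \<or> t \<in> N q"
      if q: "lpath q" and "1 \<le> s" "s \<le> 2 * k + 2" "1 \<le> t" "t \<le> 2 * k + 2" "s \<noteq> t" for q s t
    proof (rule card_ge_two_notin[of "{1..2 * k + 2}"])
      show "N q \<subseteq> {1..2 * k + 2}"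
      proof
        fix i assume "i \<in> N q"
        from N_pos[OF this] N_le[OF q this] show "i \<in> {1..2 * k + 2}" by simp
      qed
    qed (use that card_N[OF q] in auto)
    have end_closed: "v \<in> U" if "lpath q" "q ` {..2 * k + 2} = U" "v \<in> W" "E (q 0) v" for q v
      using nbr_on_path[OF that(1,3,4)] N_le[OF that(1)] that(2) by auto
    have rotU: "rot q x ` {..2 * k + 2} = q ` {..2 * k + 2}" if "lpath q" "x \<in> N q" for q x
      using rot_image[of x "2 * k + 2" q] N_pos[OF that(2)] N_le[OF that] by blast
    have rot1: "v \<in> U" if "x \<in> N p" "v \<in> W" "E (p (x - 1)) v" for x v
    proof (rule end_closed[of "rot p x"])
      show "E (rot p x 0) v" using that N_pos[of x] by (auto simp: rot_def)
    qed (use that p lpath_rot rotU in \<open>auto simp: U_def\<close>)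
    have rot2: "v \<in> U"
      if x: "x \<in> N p" and y: "y \<in> N (rot p x)" and v: "v \<in> W" "E (rot p x (y - 1)) v" for x y v
    proof (rule end_closed[of "rot (rot p x) y"])
      have q: "lpath (rot p x)" by (rule lpath_rot[OF p(1) x])
      show "lpath (rot (rot p x) y)" by (rule lpath_rot[OF q y])
      show "E (rot (rot p x) y 0) v" using v N_pos[OF y] by (auto simp: rot_def[of _ y])
      show "rot (rot p x) y ` {..2 * k + 2} = U"
        unfolding rotU[OF q y] rotU[OF p(1) x] U_def ..
    qed (rule v)
    have closed: "v \<in> U" if y: "y \<le> 2 * k + 1" and v: "v \<in> W" "E (p y) v" for y v
    proof (cases "y + 1 \<in> N p")
      case True
      then show ?thesis using rot1[of "y + 1" v] v by simp
    next
      case False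
      then have "y \<noteq> 0" "y \<noteq> 2 * k + 1"
        using one_N[OF p(1)] p(2) \<open>M = 2 * k + 2\<close> by (auto intro: ccontr)
      with y have y: "1 \<le> y" "y \<le> 2 * k" by auto
      have others: "s \<in> N p" if "1 \<le> s" "s \<le> 2 * k + 2" "s \<noteq> y + 1" for s
        using miss[OF p(1), of s "y + 1"] that False y by auto
      show ?thesis
      proof (cases "y = 1")
        case True
        \<comment> \<open>Rotating at 4 puts \<open>p 0\<close> at position 3 and \<open>p 1\<close>
          at position 2; rotating at 3 then makes \<open>p 1\<close> the end.\<close>
        have N34: "3 \<in> N p" "4 \<in> N p" using others[of 3] others[of 4] True k3 by auto
        have "3 \<in> N (rot p 4)"
          using in_N_rot[OF p(1) N34(2), of 3] N_E'[OF N34(1)] len k3 by simp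
        moreover have "rot p 4 (3 - 1) = p y" using True by (simp add: rot_def)
        ultimately show ?thesis using rot2[OF N34(2), of 3 v] v by simp
      next
        case False
        then have y2: "2 \<le> y" using y by simp
        have N2: "2 \<in> N p" "y + 2 \<in> N p" using others[of 2] others[of "y + 2"] y y2 by auto
        \<comment> \<open>The end of \<open>r\<close> is \<open>p (y + 1)\<close>, which misses
          \<open>p 0\<close> and hence sees \<open>p 1\<close>. So after rotating \<open>p\<close>
          at 2, which makes \<open>p 1\<close> the end, a rotation at \<open>y + 1\<close> brings
          \<open>p y\<close> to the end.\<close>
        define r where "r = rot p (y + 2)"
        have r: "lpath r" unfolding r_def by (rule lpath_rot[OF p(1) N2(2)])
        have "y + 1 \<notin> N r"
        proof
          assume "y + 1 \<in> N r"
          then have "E (p (y + 1)) (p 0)"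
            using in_N_rot[OF p(1) N2(2), of "y + 1"] y len by (simp add: r_def)
          from sym[OF this] have "y + 1 \<in> N p" using y len by (simp add: N_def)
          then show False using \<open>y + 1 \<notin> N p\<close> by blast
        qed
        then have "y \<in> N r" using miss[OF r, of y "y + 1"] y by auto
        then have "E (p (y + 1)) (p 1)"
          using in_N_rot[OF p(1) N2(2), of y] y len by (simp add: r_def)
        from sym[OF this] have "y + 1 \<in> N (rot p 2)"
          using in_N_rot[OF p(1) N2(1), of "y + 1"] y y2 len by simp
        moreover have "rot p 2 (y + 1 - 1) = p y" using y2 by (simp add: rot_def)
        ultimately show ?thesis using rot2[OF N2(1), of "y + 1" v] v by simp
      qed
    qed
    have inj: "inj_on p {..2 * k + 2}"
      using p(1) len by (auto simp: path_def intro: inj_on_subset)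
    show thesis
    proof (rule that)
      show "U \<subseteq> W" using lpath_in_W[OF p(1)] len by (auto simp: U_def)
      show "p (2 * k + 2) \<in> U" by (auto simp: U_def)
      show "card U = 2 * k + 3" unfolding U_def card_image[OF inj] by simp
      fix u v assume u: "u \<in> U - {p (2 * k + 2)}" and v: "v \<in> W" "E u v"
      then obtain y where y: "y \<le> 2 * k + 2" "u = p y" by (auto simp: U_def)
      then have "y \<noteq> 2 * k + 2" using u by auto
      then show "v \<in> U" using closed[of y v] y v by simp
    qed
  qed
qed

text \<open>If \<open>U\<close> is a proper subset, the colourings on the two sides of
  \<open>c\<close> are glued. If \<open>U = W\<close>, the degrees leave each vertex at most one
  non-neighbour.\<close>

lemma colourable_if_proper_subsets_colourable:
  assumes no_clique: "\<And>K. K \<subseteq> W \<Longrightarrow> (\<And>u v. u \<in> K \<Longrightarrow> v \<in> K \<Longrightarrow> u \<noteq> v \<Longrightarrow> E u v) \<Longrightarrow> card K \<le> 2 * k + 1"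
    and sub: "\<And>S. S \<subset> W \<Longrightarrow> colourable E (2 * k + 1) S"
  shows "colourable E (2 * k + 1) W"
proof -
  obtain U c where U: "U \<subseteq> W" "c \<in> U" "card U = 2 * k + 3"
    "\<And>u v. u \<in> U - {c} \<Longrightarrow> v \<in> W \<Longrightarrow> E u v \<Longrightarrow> v \<in> U"
    using clique_or_cut[OF no_clique] by blast
  show ?thesis
  proof (cases "U = W")
    case False
    have "U \<noteq> {c}" using U(3) by auto
    then have "W - (U - {c}) \<subset> W" using U(1,2) by auto
    then have "colourable E (2 * k + 1) (W - (U - {c}))" by (rule sub)
    moreover have "colourable E (2 * k + 1) U" using False U(1) by (intro sub) blast
    ultimately show ?thesis
      using colourable_cut_vertex[of E "2 * k + 1" U W c, OF sym] U by blast
  next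
    case True
    then have cW: "card W = 2 * k + 3" using U by simp
    have one: "x = y" if "w \<in> W" "x \<in> W" "y \<in> W" "x \<noteq> w" "y \<noteq> w" "\<not> E w x" "\<not> E w y" for w x y
    proof (rule ccontr)
      assume "x \<noteq> y"
      then have "x \<in> {v \<in> W. E w v} \<or> y \<in> {v \<in> W. E w v}"
        using that cW finW deg[of w] irrefl
        by (intro card_ge_two_notin[of "W - {w}"]) auto
      then show False using that by simp
    qed
    have "\<not> card W \<le> 2 * k + 1" using cW by simp
    then obtain a b where ab: "a \<in> W" "b \<in> W" "a \<noteq> b" "\<not> E a b"
      using no_clique[of W] by blast
    \<comment> \<open>Removing \<open>b\<close> still leaves too many vertices for a clique, which
      gives a second non-adjacent pair; by \<open>one\<close> it is disjoint from the first.\<close>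
    have "\<not> card (W - {b}) \<le> 2 * k + 1" using cW ab(2) finW by simp
    then obtain c d where cd: "c \<in> W - {b}" "d \<in> W - {b}" "c \<noteq> d" "\<not> E c d"
      using no_clique[of "W - {b}"] by blast
    have "a \<noteq> c" using one[of a b d] ab cd by auto
    moreover have "a \<noteq> d" using one[of a b c] ab cd sym[of c a] sym[of c d] sym[of d c] by auto
    ultimately show ?thesis
      using ab cd cW
      by (intro colourable_two_nonadjacent_pairs[of E W _ a b c d, OF sym irrefl finW]) auto
  qed
qed

end

section \<open>The chromatic number\<close>

text \<open>Library walks are lists of arcs, so the vertex lists of the combinatorial part have to
  be translated.\<close>

lemma (in wf_digraph) awalk_of_verts:
  assumes "vs \<noteq> []" "set vs \<subseteq> verts G" "successively (\<lambda>u v. u \<rightarrow>\<^bsub>G\<^esub> v) vs"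
  shows "\<exists>p. awalk (hd vs) p (last vs) \<and> awalk_verts (hd vs) p = vs"
  using assms
proof (induction vs)
  case (Cons u vs)
  show ?case
  proof (cases "vs = []")
    case True
    then show ?thesis using Cons.prems by (intro exI[of _ "[]"]) (auto simp: awalk_Nil_iff)
  next
    case False
    then have "u \<rightarrow>\<^bsub>G\<^esub> hd vs" using Cons.prems by (simp add: successively_Cons)
    then obtain e where e: "e \<in> arcs G" "tail G e = u" "head G e = hd vs"
      by (auto simp: arcs_ends_def arc_to_ends_def)
    obtain p where "awalk (hd vs) p (last vs)" "awalk_verts (hd vs) p = vs"
      using Cons False by (auto simp: successively_Cons)
    then show ?thesis
      using False e by (intro exI[of _ "e # p"]) (simp add: awalk_Cons_iff)
  qed
qed simp

lemma (in wf_digraph) undirected_cycle_of_verts: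
  assumes c: "set c \<subseteq> verts G" "distinct c" "3 \<le> length c"
    and walk: "successively (\<lambda>u v. u \<rightarrow>\<^bsub>G\<^esub> v) c" "last c \<rightarrow>\<^bsub>G\<^esub> hd c"
  shows "\<exists>p. undirected_cycle G p \<and> length p = length c"
proof -
  have ne: "c \<noteq> []" using c by auto
  \<comment> \<open>Repeating the first vertex closes the walk; the vertex list has one entry more
    than the arc list, so \<open>p\<close> has the length of \<open>c\<close>.\<close>
  have "\<exists>p. awalk (hd (c @ [hd c])) p (last (c @ [hd c])) \<and> awalk_verts (hd (c @ [hd c])) p = c @ [hd c]"
    using c walk ne by (intro awalk_of_verts) (auto simp: successively_append_iff)
  then obtain p where p: "awalk (hd c) p (hd c)" "awalk_verts (hd c) p = c @ [hd c]"
    using ne by auto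
  then have len: "length p = length c"
    using length_awalk_verts[of "hd c" p] by simp
  have "distinct (tl (awalk_verts (hd c) p))"
    unfolding p(2) using c(2) ne by (cases c) auto
  then have "cycle p" unfolding cycle_def using p(1) len ne by auto
  then show ?thesis using len c(3) by (auto simp: undirected_cycle_def)
qed

text \<open>Induction over subsets makes a non-colourable \<open>W\<close> minimal, while
  \<open>k\<close> and the set of lengths stay those of \<open>G\<close>.\<close>

lemma colourable_if_no_clique:
  fixes G :: "('a, 'b) pre_digraph"
  assumes G: "graph G" and k: "k = card (even_cycle_lengths G)" "3 \<le> k"
    and no_clique: "\<And>K. clique G K \<Longrightarrow> card K \<le> 2 * k + 1"
    and S: "S \<subseteq> verts G"
  shows "colourable (\<lambda>u v. u \<rightarrow>\<^bsub>G\<^esub> v) (2 * k + 1) S"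
proof -
  interpret graph G by fact
  let ?E = "\<lambda>u v. u \<rightarrow>\<^bsub>G\<^esub> v"
  have sym: "?E v u" if "?E u v" for u v
    using that arcs_ends_symmetric[OF sym_arcs] by blast
  have irrefl: "\<not> ?E u u" for u using adj_not_same by blast
  have "finite S" using S finite_verts by (rule finite_subset)
  then show ?thesis
    using S
  proof (induction S rule: finite_psubset_induct)
    case (psubset W)
    then have sub: "colourable ?E (2 * k + 1) T" if "T \<subset> W" for T
      using that by blast
    show ?case
    proof (rule ccontr)
      assume not_col: "\<not> colourable ?E (2 * k + 1) W"
      have "few_even_cycles ?E W (even_cycle_lengths G) k"
      proof
        show "W \<noteq> {}" using not_col by (auto simp: colourable_def)
        show "2 < l" if "l \<in> even_cycle_lengths G" for l
          using that by (auto simp: even_cycle_lengths_def undirected_cycle_def)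
        show "even l" if "l \<in> even_cycle_lengths G" for l
          using that by (auto simp: even_cycle_lengths_def)
        show "length c \<in> even_cycle_lengths G"
          if "set c \<subseteq> W" "distinct c" "3 \<le> length c" "even (length c)"
            "successively ?E c" "?E (last c) (hd c)" for c
          using undirected_cycle_of_verts[of c] that psubset.prems
          by (auto simp: even_cycle_lengths_def)
        show "2 * k + 1 \<le> card {v \<in> W. ?E w v}" if "w \<in> W" for w
          using that by (intro degree_ge_if_not_colourable[OF sym irrefl psubset.hyps that not_col] sub) auto
      qed (use sym irrefl psubset.hyps finite_even_cycle_lengths k in simp_all)
      then interpret few_even_cycles ?E W "even_cycle_lengths G" k .
      have "card K \<le> 2 * k + 1"
        if "K \<subseteq> W" "\<And>u v. u \<in> K \<Longrightarrow> v \<in> K \<Longrightarrow> u \<noteq> v \<Longrightarrow> ?E u v" for K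
        using that psubset.prems by (intro no_clique) (auto simp: clique_def)
      then show False
        using colourable_if_proper_subsets_colourable sub not_col by blast
    qed
  qed
qed

theorem theorem9:
  fixes G :: "('a, 'b) pre_digraph"
  assumes "graph G"
    and "Digraph_Component.connected G"
    and "card (even_cycle_lengths G) \<ge> 3"
    and "clique_number G \<le> 2 * card (even_cycle_lengths G) + 1"
  shows "chromatic_number G \<le> 2 * card (even_cycle_lengths G) + 1"
proof -
  interpret graph G by fact
  let ?k = "card (even_cycle_lengths G)"
  have "finite {card K | K. clique G K}"
    by (rule finite_subset[of _ "card ` Pow (verts G)"]) (auto simp: clique_def)
  then have "card K \<le> clique_number G" if "clique G K" for K
    using that unfolding clique_number_def by (intro Max_ge) auto
  then have "card K \<le> 2 * ?k + 1" if "clique G K" for K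
    using that assms(4) le_trans by blast
  then have "colourable (\<lambda>u v. u \<rightarrow>\<^bsub>G\<^esub> v) (2 * ?k + 1) (verts G)"
    by (intro colourable_if_no_clique[OF assms(1) refl assms(3)]) auto
  then obtain f where "f ` verts G \<subseteq> {..<2 * ?k + 1}"
    "\<forall>u\<in>verts G. \<forall>v\<in>verts G. u \<rightarrow>\<^bsub>G\<^esub> v \<longrightarrow> f u \<noteq> f v"
    unfolding colourable_def by blast
  then have "proper_colouring G (2 * ?k + 1) f"
    unfolding proper_colouring_def using adj_in_verts by blast
  then show ?thesis
    unfolding chromatic_number_def by (intro Least_le) blast
qed

end
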